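(* Let $n\ge 1$ and $1\le M\le \binom{n}{2}$ be integers, and let $\mathbf{D}$ be the random oriented directed graph on $n$ vertices obtained by choosing a set of $M$ unordered pairs of distinct vertices uniformly at random among all $M$-element subsets of the $\binom{n}{2}$ pairs, and then orienting each chosen pair independently in each of its two directions with probability $1/2$. Let $\mathbf{Y}^*$ be the size of a minimum feedback arc set of $\mathbf{D}$ (the minimum number of arcs whose removal makes $\mathbf{D}$ acyclic), and let $\Delta_{av}=2M/n$ be the average vertex degree. Then $$\Pr\left(\mathbf{Y}^*\ge M\left(\frac{1}{2}-\sqrt{\frac{\log n}{\Delta_{av}}}\right)\right)\ge 1-3\sqrt{n}\,e^{-n}.$$
   Context: $\log$ denotes the natural logarithm. Equivalently, $\mathbf{Y}^*$ is the minimum, over all orderings of the vertices, of the number of arcs going from a later vertex to an earlier vertex. *)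

theory Defs
  imports "HOL-Probability.Probability"
begin

definition vertex_pairs :: "nat \<Rightarrow> nat set set" where
  "vertex_pairs n = {e. e \<subseteq> {..<n} \<and> card e = 2}"

(* Both arcs on the pair e: for u \<noteq> v, arcs_on {u, v} = {(u, v), (v, u)}. *)
definition arcs_on :: "'a set \<Rightarrow> ('a \<times> 'a) set" where
  "arcs_on e = {(u, v). {u, v} = e}"

(* The digraph has vertex set {..<n} and is represented by its arc set.
   Pi_pmf is the product measure, so the arcs chosen for distinct pairs are
   independent. Its default value, used only outside E, does not affect the result. *)
definition random_digraph :: "nat \<Rightarrow> nat \<Rightarrow> (nat \<times> nat) set pmf" where
  "random_digraph n M =
     do {
       E \<leftarrow> pmf_of_set {E. E \<subseteq> vertex_pairs n \<and> card E = M};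
       \<sigma> \<leftarrow> Pi_pmf E undefined (\<lambda>e. pmf_of_set (arcs_on e));
       return_pmf (\<sigma> ` E)
     }"

definition feedback_arc_set :: "('a \<times> 'a) set \<Rightarrow> ('a \<times> 'a) set \<Rightarrow> bool" where
  "feedback_arc_set D F \<longleftrightarrow> F \<subseteq> D \<and> acyclic (D - F)"

(* Meaningful for finite D. *)
definition min_feedback_arc_size :: "('a \<times> 'a) set \<Rightarrow> nat" where
  "min_feedback_arc_size D = Min {card F | F. feedback_arc_set D F}"

end

theory Submission
  imports Defs
begin

text \<open>
  Fix an ordering of the vertices. Whatever pairs are chosen, each of the \<open>M\<close> arcs is backward
  independently with probability \<open>1/2\<close>, so the number of backward arcs is binomially distributed,
  and Hoeffding's inequality bounds the probability that it is at most
  \<open>M (1/2 - sqrt (ln n / (2 M / n)))\<close> by \<open>exp (- n ln n) = n powr (- n)\<close>. Since the minimum feedback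
  arc set has as many elements as the backward arcs of some ordering (a topological
  order of the remaining acyclic digraph), a union bound over the \<open>n!\<close> orderings together with
  \<open>n! \<le> e sqrt n (n/e)^n\<close> gives the claim.
\<close>

section \<open>Topological orders and feedback arc sets\<close>

lemma acyclic_imp_topological_order:
  fixes A :: "'a set"
  assumes "finite A" "acyclic r" "r \<subseteq> A \<times> A"
  shows "\<exists>f. bij_betw f A {..<card A} \<and> (\<forall>(u, v)\<in>r. f u < f v)"
  using assms
proof (induction "card A" arbitrary: A r)
  case 0
  then show ?case by (auto simp: bij_betw_def)
next
  case (Suc k)
  have "finite r"
    using Suc.prems by (meson finite_SigmaI finite_subset)
  \<comment> \<open>A minimal element for the converse relation is a sink: since \<open>r\<close>
    stays inside \<open>A\<close>, no arc leaves \<open>z\<close>.\<close>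
  then have "wf (r\<inverse>)"
    using Suc.prems(2) by (rule finite_acyclic_wf_converse)
  moreover obtain a where "a \<in> A"
    using Suc.hyps(2) by fastforce
  ultimately obtain z where z: "z \<in> A" "\<And>y. (z, y) \<in> r \<Longrightarrow> y \<notin> A"
    by (metis converse_iff wf_eq_minimal)
  define B where "B = A - {z}"
  have B: "finite B" "card B = k"
    using Suc.hyps(2) Suc.prems(1) z(1) by (auto simp: B_def)
  have "acyclic (r \<inter> B \<times> B)"
    using Suc.prems(2) by (rule acyclic_subset) auto
  with Suc.hyps(1)[of B "r \<inter> B \<times> B"] B
  obtain f where f: "bij_betw f B {..<k}" "\<forall>(u, v)\<in>r \<inter> B \<times> B. f u < f v"
    by auto
  \<comment> \<open>The sink comes last, with the largest label \<open>k\<close>; arcs into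
    \<open>z\<close> then increase because \<open>f\<close> stays below \<open>k\<close> on
    \<open>B\<close>.\<close>
  define g where "g = f(z := k)"
  have "bij_betw g B {..<k}"
    using f(1) by (rule iffD1[OF bij_betw_cong, rotated]) (auto simp: g_def B_def)
  then have "bij_betw g (B \<union> {z}) ({..<k} \<union> {g z})"
    by (intro notIn_Un_bij_betw) (auto simp: B_def g_def)
  moreover have "B \<union> {z} = A" "{..<k} \<union> {g z} = {..<card A}"
    using z(1) Suc.hyps(2) by (auto simp: B_def g_def)
  moreover have "g u < g v" if "(u, v) \<in> r" for u v
  proof -
    have uv: "u \<in> B" "v \<in> A"
      using that z Suc.prems(3) by (auto simp: B_def)
    then have "f u < k"
      using f(1) by (auto simp: bij_betw_def)
    with uv that f(2) show ?thesis
      by (auto simp: g_def B_def)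
  qed
  ultimately show ?case
    by (intro exI[of _ g]) auto
qed

lemma min_feedback_arc_size_attained:
  assumes "finite D"
  obtains F where "feedback_arc_set D F" "card F = min_feedback_arc_size D"
proof -
  let ?S = "{card F | F. feedback_arc_set D F}"
  have "?S \<subseteq> card ` Pow D"
    by (auto simp: feedback_arc_set_def)
  then have "finite ?S"
    using assms by (meson finite_Pow_iff finite_imageI finite_subset)
  moreover have "feedback_arc_set D D"
    by (simp add: feedback_arc_set_def acyclic_def)
  then have "?S \<noteq> {}"
    by blast
  ultimately have "Min ?S \<in> ?S"
    by (rule Min_in)
  with that show ?thesis
    unfolding min_feedback_arc_size_def by auto
qed

text \<open>In a topological order of \<open>D - F\<close>, with \<open>F\<close> a minimum feedback
  arc set, every backward arc of \<open>D\<close> must lie in \<open>F\<close>. This one inequality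
  suffices for a lower bound on the minimum.\<close>

lemma exists_ordering_backward_arcs_le:
  fixes n :: nat
  assumes "D \<subseteq> {..<n} \<times> {..<n}"
  obtains f where "f permutes {..<n}"
    "card {(u, v) \<in> D. f v < f u} \<le> min_feedback_arc_size D"
proof -
  have fin: "finite D"
    using assms by (meson finite_SigmaI finite_lessThan finite_subset)
  then obtain F where F: "feedback_arc_set D F" "card F = min_feedback_arc_size D"
    by (rule min_feedback_arc_size_attained)
  have "acyclic (D - F)"
    using F by (simp add: feedback_arc_set_def)
  moreover have "D - F \<subseteq> {..<n} \<times> {..<n}"
    using assms by auto
  ultimately obtain g where
    g: "bij_betw g {..<n} {..<n}" "\<forall>(u, v)\<in>D - F. g u < g v"
    using acyclic_imp_topological_order[of "{..<n}" "D - F"] by auto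
  \<comment> \<open>\<open>permutes\<close> demands the identity outside the vertex set, where
    \<open>g\<close> is arbitrary.\<close>
  define f where "f u = (if u < n then g u else u)" for u
  have "bij_betw f {..<n} {..<n}"
    using g(1) by (rule iffD1[OF bij_betw_cong, rotated]) (auto simp: f_def)
  then have "f permutes {..<n}"
    by (rule bij_imp_permutes) (auto simp: f_def)
  moreover have "{(u, v) \<in> D. f v < f u} \<subseteq> F"
  proof clarify
    fix u v assume uv: "(u, v) \<in> D" "f v < f u"
    then have "\<not> g u < g v"
      using assms by (auto simp: f_def)
    with g(2) uv(1) show "(u, v) \<in> F"
      by blast
  qed
  then have "card {(u, v) \<in> D. f v < f u} \<le> card F"
    using F(1) fin by (intro card_mono) (auto simp: feedback_arc_set_def intro: finite_subset)
  ultimately show ?thesis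
    using that F(2) by auto
qed

section \<open>Vertex pairs and the support of the random digraph\<close>

lemma arcs_on_doubleton: "arcs_on {u, v} = {(u, v), (v, u)}"
  by (auto simp: arcs_on_def doubleton_eq_iff)

lemma finite_vertex_pairs: "finite (vertex_pairs n)"
  by (rule finite_subset[of _ "Pow {..<n}"]) (auto simp: vertex_pairs_def)

lemma card_vertex_pairs: "card (vertex_pairs n) = n choose 2"
  unfolding vertex_pairs_def by (simp add: n_subsets)

lemma vertex_pairsE:
  assumes "e \<in> vertex_pairs n"
  obtains u v where "e = {u, v}" "u \<noteq> v" "u < n" "v < n"
  using assms unfolding vertex_pairs_def card_2_iff by auto

lemma edge_sets:
  assumes "M \<le> n choose 2"
  shows "finite {E. E \<subseteq> vertex_pairs n \<and> card E = M}"
    and "{E. E \<subseteq> vertex_pairs n \<and> card E = M} \<noteq> {}"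
proof -
  show "finite {E. E \<subseteq> vertex_pairs n \<and> card E = M}"
    by (rule finite_subset[of _ "Pow (vertex_pairs n)"]) (auto simp: finite_vertex_pairs)
  show "{E. E \<subseteq> vertex_pairs n \<and> card E = M} \<noteq> {}"
    using obtain_subset_with_card_n[of M "vertex_pairs n"] assms
    by (auto simp: card_vertex_pairs)
qed

lemma orientation_mem_arcs_on:
  assumes "E \<subseteq> vertex_pairs n" "\<sigma> \<in> set_pmf (Pi_pmf E undefined (\<lambda>e. pmf_of_set (arcs_on e)))"
    and "e \<in> E"
  shows "\<sigma> e \<in> arcs_on e"
proof -
  have "finite E"
    using assms(1) finite_vertex_pairs by (rule finite_subset)
  then have "\<sigma> e \<in> set_pmf (pmf_of_set (arcs_on e))"
    using assms by (auto simp: set_Pi_pmf PiE_dflt_def)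
  moreover obtain u v where "e = {u, v}"
    using assms vertex_pairsE by blast
  ultimately show ?thesis
    by (simp add: arcs_on_doubleton)
qed

lemma set_random_digraph:
  assumes "M \<le> n choose 2" "D \<in> set_pmf (random_digraph n M)"
  shows "D \<subseteq> {..<n} \<times> {..<n}"
proof -
  obtain E \<sigma> where E: "E \<subseteq> vertex_pairs n" and D: "D = \<sigma> ` E"
    and \<sigma>: "\<sigma> \<in> set_pmf (Pi_pmf E undefined (\<lambda>e. pmf_of_set (arcs_on e)))"
    using assms(2) edge_sets[OF assms(1)] by (auto simp: random_digraph_def)
  have "\<sigma> e \<in> {..<n} \<times> {..<n}" if e: "e \<in> E" for e
  proof -
    obtain u v where "e = {u, v}" "u < n" "v < n"
      using e E vertex_pairsE by blast
    with orientation_mem_arcs_on[OF E \<sigma> e] show ?thesis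
      by (auto simp: arcs_on_doubleton)
  qed
  then show ?thesis
    using D by blast
qed

section \<open>Distribution of the number of backward arcs\<close>

lemma map_pmf_arcs_on:
  assumes "u \<noteq> v" "P (u, v) \<longleftrightarrow> \<not> P (v, u)"
  shows "map_pmf P (pmf_of_set (arcs_on {u, v})) = bernoulli_pmf (1 / 2)"
proof -
  \<comment> \<open>Exactly one orientation satisfies \<open>P\<close>, so \<open>P\<close> carries
    the uniform choice of an arc to a fair coin.\<close>
  have "bij_betw P {(u, v), (v, u)} UNIV"
    using assms by (auto simp: bij_betw_def inj_on_def UNIV_bool)
  then show ?thesis
    by (simp add: arcs_on_doubleton bernoulli_pmf_half_conv_pmf_of_set map_pmf_of_set_bij_betw)
qed

text \<open>Given the edge set, the values of \<open>P\<close> on the chosen arcs are independent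
  fair coins. The resulting law depends only on the number \<open>M\<close> of edges, so averaging
  over the edge set leaves it unchanged.\<close>

lemma backward_arcs_binomial:
  assumes M: "M \<le> n choose 2"
    and P: "\<And>u v. u < n \<Longrightarrow> v < n \<Longrightarrow> u \<noteq> v \<Longrightarrow> P (u, v) \<longleftrightarrow> \<not> P (v, u)"
  shows "map_pmf (\<lambda>D. card {a \<in> D. P a}) (random_digraph n M) = binomial_pmf M (1 / 2)"
proof -
  have orient: "map_pmf (\<lambda>\<sigma>. card {a \<in> \<sigma> ` E. P a}) (Pi_pmf E undefined (\<lambda>e. pmf_of_set (arcs_on e)))
      = binomial_pmf M (1 / 2)"
    if E: "E \<subseteq> vertex_pairs n" "card E = M" for E
  proof -
    have fin: "finite E"
      using E(1) finite_vertex_pairs by (rule finite_subset)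
    let ?O = "Pi_pmf E undefined (\<lambda>e. pmf_of_set (arcs_on e))"
    have card_eq: "card {a \<in> \<sigma> ` E. P a} = card {e \<in> E. (P \<circ> \<sigma>) e}"
      if \<sigma>: "\<sigma> \<in> set_pmf ?O" for \<sigma>
    proof -
      \<comment> \<open>The endpoints of an arc recover its pair, so distinct pairs give distinct
        arcs and counting arcs amounts to counting pairs.\<close>
      have "{fst (\<sigma> e), snd (\<sigma> e)} = e" if "e \<in> E" for e
        using orientation_mem_arcs_on[OF E(1) \<sigma> that] by (simp add: arcs_on_def split_beta)
      then have "inj_on \<sigma> E"
        by (metis inj_onI)
      moreover have "{a \<in> \<sigma> ` E. P a} = \<sigma> ` {e \<in> E. (P \<circ> \<sigma>) e}"
        by auto
      ultimately show ?thesis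
        by (simp add: card_image inj_on_subset)
    qed
    have "map_pmf (\<lambda>\<sigma>. card {a \<in> \<sigma> ` E. P a}) ?O
        = map_pmf (\<lambda>h. card {e \<in> E. h e}) (map_pmf (\<lambda>\<sigma>. P \<circ> \<sigma>) ?O)"
      unfolding map_pmf_comp by (rule map_pmf_cong) (use card_eq in auto)
    \<comment> \<open>Composing with \<open>P\<close> also maps the default value outside
      \<open>E\<close>, hence \<open>P undefined\<close>.\<close>
    also have "map_pmf (\<lambda>\<sigma>. P \<circ> \<sigma>) ?O
        = Pi_pmf E (P undefined) (\<lambda>e. map_pmf P (pmf_of_set (arcs_on e)))"
      by (rule Pi_pmf_map[symmetric]) (use fin in auto)
    also have "\<dots> = Pi_pmf E (P undefined) (\<lambda>_. bernoulli_pmf (1 / 2))"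
    proof (rule Pi_pmf_cong)
      fix e assume "e \<in> E"
      with E obtain u v where "e = {u, v}" "u \<noteq> v" "u < n" "v < n"
        using vertex_pairsE by blast
      then show "map_pmf P (pmf_of_set (arcs_on e)) = bernoulli_pmf (1 / 2)"
        using map_pmf_arcs_on P by metis
    qed auto
    also have "map_pmf (\<lambda>h. card {e \<in> E. h e}) \<dots> = binomial_pmf M (1 / 2)"
      by (rule binomial_pmf_altdef'[symmetric]) (use fin E in auto)
    finally show ?thesis .
  qed
  have "map_pmf (\<lambda>D. card {a \<in> D. P a}) (random_digraph n M)
      = pmf_of_set {E. E \<subseteq> vertex_pairs n \<and> card E = M} \<bind>
          (\<lambda>E. map_pmf (\<lambda>\<sigma>. card {a \<in> \<sigma> ` E. P a}) (Pi_pmf E undefined (\<lambda>e. pmf_of_set (arcs_on e))))"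
    by (simp add: random_digraph_def map_bind_pmf map_pmf_def bind_assoc_pmf bind_return_pmf)
  also have "\<dots> = pmf_of_set {E. E \<subseteq> vertex_pairs n \<and> card E = M} \<bind> (\<lambda>_. binomial_pmf M (1 / 2))"
    by (rule bind_pmf_cong) (use orient edge_sets[OF M] in auto)
  finally show ?thesis
    by simp
qed

lemma prob_backward_arcs_le:
  assumes M: "1 \<le> M" "M \<le> n choose 2" and f: "f permutes {..<n}" and t: "t \<ge> 0"
  shows "measure_pmf.prob (random_digraph n M)
      {D. real (card {(u, v) \<in> D. f v < f u}) \<le> M * (1 / 2 - t)} \<le> exp (- 2 * M * t\<^sup>2)"
proof -
  let ?back = "\<lambda>D. card {a \<in> D. case a of (u, v) \<Rightarrow> f v < f u}"
  have arcs_eq: "{a \<in> D. case a of (u, v) \<Rightarrow> f v < f u} = {(u, v) \<in> D. f v < f u}" for D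
    by auto
  interpret binomial_distribution M "1 / 2"
    by unfold_locales auto
  have "f u \<noteq> f v" if "u \<noteq> v" for u v
    using permutes_inj[OF f] that by (auto dest: injD)
  then have binom: "map_pmf ?back (random_digraph n M) = binomial_pmf M (1 / 2)"
    by (intro backward_arcs_binomial[OF M(2)]) (auto simp: not_less nat_less_le)
  have "{D. real (?back D) \<le> M * (1 / 2 - t)} = ?back -` {x. x \<le> M * (1 / 2) - M * t}"
    by (auto simp: algebra_simps)
  then have "measure_pmf.prob (random_digraph n M) {D. real (?back D) \<le> M * (1 / 2 - t)}
      = measure_pmf.prob (binomial_pmf M (1 / 2)) {x. x \<le> M * (1 / 2) - M * t}"
    by (simp flip: binom)
  \<comment> \<open>Hoeffding's inequality for a deviation of \<open>M * t\<close> below the mean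
    \<open>M / 2\<close>.\<close>
  also have "\<dots> \<le> exp (- 2 * (M * t)\<^sup>2 / M)"
    by (rule prob_le) (use M t in auto)
  also have "- 2 * (M * t)\<^sup>2 / M = - 2 * M * t\<^sup>2"
    using M by (simp add: power2_eq_square)
  finally show ?thesis
    by (simp add: arcs_eq)
qed

text \<open>Equality holds at \<open>n = 1\<close>. With \<open>r = (n + 1) / n\<close>, passing to
  \<open>n + 1\<close> multiplies the right side by \<open>(n + 1) * r ^ n * sqrt r / exp 1\<close>
  and the factorial by \<open>n + 1\<close>, so the induction step reduces to
  \<open>exp 1 \<le> r powr (n + 1 / 2)\<close>.\<close>

lemma fact_le_stirling:
  assumes "n \<ge> 1"
  shows "fact n \<le> exp 1 * sqrt n * (n / exp 1) ^ n"
  using assms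
proof (induction n rule: nat_induct_at_least)
  case base
  then show ?case by simp
next
  case (Suc n)
  have n: "real n > 0"
    using Suc.hyps by simp
  define r where "r = (n + 1) / real n"
  have r: "r > 0"
    using n by (simp add: r_def)
  \<comment> \<open>By convexity, the integral of \<open>1 / x\<close> from \<open>n\<close> to
    \<open>n + 1\<close> is at least its value at the midpoint.\<close>
  have "2 / (2 * real n + 1) \<le> ln r"
    using ln_inverse_approx_ge[of "real n" "real n + 1"] n
    by (simp add: r_def ln_div add_ac)
  then have "1 \<le> (n + 1 / 2) * ln r"
    using n by (simp add: field_simps)
  then have "exp 1 \<le> r powr (n + 1 / 2)"
    using r by (simp add: powr_def)
  also have "\<dots> = r ^ n * sqrt r"
    using r by (simp add: powr_add powr_realpow powr_half_sqrt)
  finally have e: "exp 1 \<le> r ^ n * sqrt r" .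
  have "fact (Suc n) = (n + 1) * (fact n :: real)"
    by simp
  also have "\<dots> \<le> (n + 1) * (exp 1 * sqrt n * (n / exp 1) ^ n)"
    using Suc.IH by (intro mult_left_mono) auto
  also have "\<dots> = (n + 1) * sqrt n * (n / exp 1) ^ n * exp 1"
    by simp
  also have "\<dots> \<le> (n + 1) * sqrt n * (n / exp 1) ^ n * (r ^ n * sqrt r)"
    using e by (intro mult_left_mono) auto
  also have "\<dots> = (n + 1) * (sqrt n * sqrt r) * ((n / exp 1) * r) ^ n"
    by (simp add: mult_ac flip: power_mult_distrib)
  also have "sqrt n * sqrt r = sqrt (Suc n)"
    using n by (simp add: r_def flip: real_sqrt_mult)
  also have "(n / exp 1) * r = Suc n / exp 1"
    using n by (simp add: r_def)
  also have "(n + 1) * sqrt (Suc n) * (Suc n / exp 1) ^ n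
      = exp 1 * sqrt (Suc n) * (Suc n / exp 1) ^ Suc n"
    by simp
  finally show ?case .
qed

theorem theorem3p1:
  fixes n M :: nat
  assumes "n \<ge> 1" and "1 \<le> M" and "M \<le> n choose 2"
  shows "measure_pmf.prob (random_digraph n M)
           {D. real (min_feedback_arc_size D) \<ge>
               real M * (1 / 2 - sqrt (ln (real n) / (2 * real M / real n)))}
         \<ge> 1 - 3 * sqrt (real n) * exp (- real n)"
proof -
  define t where "t = sqrt (ln (real n) / (2 * real M / real n))"
  let ?D = "random_digraph n M"
  let ?good = "{D. real (min_feedback_arc_size D) \<ge> M * (1 / 2 - t)}"
  let ?bad = "\<lambda>f. {D. real (card {(u, v) \<in> D. f v < f u}) \<le> M * (1 / 2 - t)}"
  let ?S = "{f. f permutes {..<n}}"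
  have t0: "t \<ge> 0"
    using assms by (simp add: t_def)
  \<comment> \<open>This makes the Hoeffding exponent exactly \<open>- (n * ln n)\<close>.\<close>
  have t2: "2 * M * t\<^sup>2 = n * ln n"
    using assms by (simp add: t_def)
  have "measure_pmf.prob ?D (- ?good) \<le> measure_pmf.prob ?D (\<Union>f\<in>?S. ?bad f)"
  \<comment> \<open>The inclusion is claimed only on the support, where all arcs join vertices below
    \<open>n\<close> and a suitable ordering exists.\<close>
  proof (rule measure_pmf.finite_measure_mono_AE)
    show "AE D in ?D. D \<in> - ?good \<longrightarrow> D \<in> (\<Union>f\<in>?S. ?bad f)"
    proof (rule AE_pmfI, rule impI)
      fix D assume D: "D \<in> set_pmf ?D" and "D \<in> - ?good"
      obtain f where "f permutes {..<n}"
        "card {(u, v) \<in> D. f v < f u} \<le> min_feedback_arc_size D"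
        using exists_ordering_backward_arcs_le[OF set_random_digraph[OF assms(3) D]] .
      with \<open>D \<in> - ?good\<close> show "D \<in> (\<Union>f\<in>?S. ?bad f)"
        by (intro UN_I[of f]) auto
    qed
  qed auto
  also have "\<dots> \<le> (\<Sum>f\<in>?S. measure_pmf.prob ?D (?bad f))"
    by (rule measure_pmf.finite_measure_subadditive_finite) (auto simp: finite_permutations)
  also have "\<dots> \<le> (\<Sum>f\<in>?S. exp (- (n * ln n)))"
    using prob_backward_arcs_le[OF assms(2,3) _ t0] t2 by (intro sum_mono) auto
  also have "\<dots> = fact n * exp (- (n * ln n))"
    by (simp add: card_permutations[of "{..<n}" n])
  also have "exp (- (n * ln n)) = 1 / real n ^ n"
    using assms(1) by (simp add: exp_minus exp_of_nat_mult inverse_eq_divide)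
  also have "fact n * (1 / real n ^ n) \<le> exp 1 * sqrt n * (n / exp 1) ^ n * (1 / real n ^ n)"
    using fact_le_stirling[OF assms(1)] by (intro mult_right_mono) auto
  \<comment> \<open>The factor \<open>n ^ n\<close> from the factorial bound cancels the tail
    probability; the final constant 3 then comes from \<open>exp 1 \<le> 3\<close>.\<close>
  also have "\<dots> = exp 1 * sqrt n * exp (- real n)"
    using assms(1) by (simp add: power_divide exp_minus field_simps flip: exp_of_nat_mult)
  also have "\<dots> \<le> 3 * sqrt n * exp (- real n)"
    using exp_le by (intro mult_right_mono) auto
  finally have "measure_pmf.prob ?D (- ?good) \<le> 3 * sqrt n * exp (- real n)" .
  moreover have "measure_pmf.prob ?D (- ?good) = 1 - measure_pmf.prob ?D ?good"
    using measure_pmf.prob_compl[of ?good ?D] by (simp add: Compl_eq_Diff_UNIV)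
  ultimately show ?thesis
    by (simp add: t_def)
qed

end
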